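(* Let $a\neq 0$ be a complex number, let $n,m\geq1$ be integers and $1\leq k\leq n$. Then $$\sum_{l_{1},\dots,l_{m-1}=0}^{n}\binom{n-1}{l_{1}-1}\binom{l_{1}-1}{l_{2}-1}\cdots\binom{l_{m-2}-1}{l_{m-1}-1}\binom{l_{m-1}-1}{k-1}(-an)^{n-l_{1}}(-al_{1})^{l_{1}-l_{2}}\cdots(-al_{m-2})^{l_{m-2}-l_{m-1}}(-al_{m-1})^{l_{m-1}-k}$$ $$=\sum_{\substack{k_{1}+k_{2}+\cdots+k_{m}=n-k\\ k_1,\dots,k_m\geq0}}\binom{n-1}{k_{1},k_{2},\dots,k_{m},k-1}\prod_{i=1}^{m}\bigl(-a(n-k_{m}-\cdots-k_{i+1})\bigr)^{k_{i}},$$ where in the product the factor with $i=m$ is $(-an)^{k_m}$.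
   Context: Binomial coefficients $\binom{p}{q}$ are taken to be $0$ when $q<0$ or $q>p$ (so any term of the left-hand sum in which the chain $n\geq l_1\geq l_2\geq\cdots\geq l_{m-1}\geq k$ with all $l_i\geq1$ fails is zero). For $m=1$ the left-hand side has no summation indices and is read as $\binom{n-1}{k-1}(-an)^{n-k}$. The multinomial coefficient is $\binom{n-1}{k_1,\dots,k_m,k-1}=\frac{(n-1)!}{k_1!\cdots k_m!\,(k-1)!}$. (These quantities arise from the Abel polynomials $A_n(x;a)=x(x-an)^{n-1}=\sum_{k=1}^n\binom{n-1}{k-1}(-an)^{n-k}x^k$.) *)

theory Defs
  imports Complex_Main "HOL-Library.FuncSet"
begin

text \<open>Both arguments are integers because \<open>l - 1\<close> with \<open>l = 0\<close> must give a vanishing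
  coefficient; truncated subtraction on \<^typ>\<open>nat\<close> would turn \<open>l = 0\<close> into a nonzero term.
  This differs from \<^const>\<open>gbinomial\<close> for negative upper argument.\<close>

definition int_binom :: "int \<Rightarrow> int \<Rightarrow> nat" where
  "int_binom p q = (if 0 \<le> q \<and> q \<le> p then nat p choose nat q else 0)"

text \<open>The summation indices are \<open>l\<^sub>1, \<dots>, l\<^bsub>m-1\<^esub>\<close>; the endpoints are fixed by
  \<open>l\<^sub>0 = n\<close> and \<open>l\<^sub>m = k\<close>.\<close>

definition with_ends :: "nat \<Rightarrow> nat \<Rightarrow> nat \<Rightarrow> (nat \<Rightarrow> nat) \<Rightarrow> nat \<Rightarrow> nat" where
  "with_ends m n k l i = (if i = 0 then n else if i = m then k else l i)"

text \<open>If some exponent is negative, the corresponding binomial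
  coefficient is \<open>0\<close>, so the value of that power is irrelevant.\<close>

definition chain_term :: "complex \<Rightarrow> nat \<Rightarrow> (nat \<Rightarrow> nat) \<Rightarrow> complex" where
  "chain_term a m l =
     (\<Prod>i=1..m. of_nat (int_binom (int (l (i - 1)) - 1) (int (l i) - 1))) *
     (\<Prod>i=1..m. (- a * of_nat (l (i - 1))) powi (int (l (i - 1)) - int (l i)))"

text \<open>The coefficient \<open>N! / (k\<^sub>1! \<cdots> k\<^sub>m! r!)\<close>, for \<open>k\<^sub>1 + \<cdots> + k\<^sub>m + r = N\<close>.\<close>

definition multinom :: "nat \<Rightarrow> nat \<Rightarrow> (nat \<Rightarrow> nat) \<Rightarrow> nat \<Rightarrow> complex" where
  "multinom N m ks r = fact N / ((\<Prod>i=1..m. fact (ks i)) * fact r)"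

definition compositions :: "nat \<Rightarrow> nat \<Rightarrow> (nat \<Rightarrow> nat) set" where
  "compositions m s = {ks \<in> {1..m} \<rightarrow>\<^sub>E UNIV. (\<Sum>i=1..m. ks i) = s}"

text \<open>Finiteness ensures that sums over \<^const>\<open>compositions\<close> do not collapse to \<open>0\<close>.\<close>

lemma finite_compositions: "finite (compositions m s)"
proof (rule finite_subset)
  show "compositions m s \<subseteq> {1..m} \<rightarrow>\<^sub>E {0..s}"
  proof
    fix ks assume ks: "ks \<in> compositions m s"
    have "ks i \<le> s" if "i \<in> {1..m}" for i
      using ks that member_le_sum[of i "{1..m}" ks] by (auto simp: compositions_def)
    with ks show "ks \<in> {1..m} \<rightarrow>\<^sub>E {0..s}"
      by (auto simp: compositions_def PiE_iff)
  qed
  show "finite ({1..m} \<rightarrow>\<^sub>E {0..s})"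
    by (intro finite_PiE) auto
qed

end

theory Submission
  imports Defs
begin

text \<open>Only weakly decreasing chains \<open>n = l\<^sub>0 \<ge> l\<^sub>1 \<ge> \<dots> \<ge> l\<^sub>m = k\<close> contribute to the left-hand side.
  They correspond bijectively to compositions of \<open>n - k\<close> via \<open>k\<^sub>j = l\<^bsub>m-j\<^esub> - l\<^bsub>m-j+1\<^esub>\<close>, and under this
  correspondence the product of binomial coefficients telescopes to the multinomial coefficient
  while \<open>n - k\<^sub>m - \<cdots> - k\<^bsub>j+1\<^esub> = l\<^bsub>m-j\<^esub>\<close>.\<close>

definition decreasing_chain :: "nat \<Rightarrow> (nat \<Rightarrow> nat) \<Rightarrow> bool" where
  "decreasing_chain m L \<longleftrightarrow> (\<forall>i\<in>{1..m}. L i \<le> L (i - 1))"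

text \<open>The restriction makes the result \<open>undefined\<close> off \<open>{1..m}\<close>, as
  membership in the extensional set \<open>compositions\<close> demands.\<close>

definition chain_steps :: "nat \<Rightarrow> (nat \<Rightarrow> nat) \<Rightarrow> nat \<Rightarrow> nat" where
  "chain_steps m L = (\<lambda>j\<in>{1..m}. L (m - j) - L (Suc m - j))"

text \<open>Steps are numbered from the lower end of the chain, so going down to position
  \<open>i\<close> uses the last \<open>i\<close> of them; for \<open>i = 0\<close> the sum is
  empty.\<close>

definition chain_of_steps :: "nat \<Rightarrow> nat \<Rightarrow> (nat \<Rightarrow> nat) \<Rightarrow> nat \<Rightarrow> nat" where
  "chain_of_steps m n ks i = n - (\<Sum>j=Suc m - i..m. ks j)"

lemma decreasing_chain_antimono:
  assumes "decreasing_chain m L" "i \<le> j" "j \<le> m"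
  shows "L j \<le> L i"
  using assms(2,3)
proof (induction j rule: dec_induct)
  case (step j)
  then have "L (Suc j) \<le> L j"
    using assms(1) by (auto simp: decreasing_chain_def dest: bspec[of _ _ "Suc j"])
  with step show ?case by simp
qed simp

text \<open>An ascent gives a binomial coefficient whose lower entry exceeds the upper one, hence a
  zero factor.\<close>

lemma chain_term_eq_0:
  assumes "\<not> decreasing_chain m L"
  shows "chain_term a m L = 0"
proof -
  obtain i where "i \<in> {1..m}" "L (i - 1) < L i"
    using assms by (auto simp: decreasing_chain_def not_le)
  then have "(\<Prod>i=1..m. of_nat (int_binom (int (L (i - 1)) - 1) (int (L i) - 1))) = (0::complex)"
    by (intro prod_zero bexI[of _ i]) (auto simp: int_binom_def)
  then show ?thesis by (simp add: chain_term_def)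
qed

text \<open>The sum telescopes; monotonicity keeps every truncated difference exact.\<close>

lemma sum_chain_steps:
  assumes "decreasing_chain m L" "i \<le> m"
  shows "(\<Sum>j=Suc m - i..m. chain_steps m L j) = L 0 - L i"
  using assms(2)
proof (induction i)
  case (Suc i)
  have "(\<Sum>j=m - i..m. chain_steps m L j)
      = chain_steps m L (m - i) + (\<Sum>j=Suc (m - i)..m. chain_steps m L j)"
    using Suc.prems by (intro sum.atLeast_Suc_atMost) simp
  also have "chain_steps m L (m - i) = L i - L (Suc i)"
    using Suc.prems by (auto simp: chain_steps_def Suc_diff_le)
  also have "(\<Sum>j=Suc (m - i)..m. chain_steps m L j) = L 0 - L i"
    using Suc by (simp add: Suc_diff_le)
  finally show ?case
    using decreasing_chain_antimono[OF assms(1), of i "Suc i"]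
      decreasing_chain_antimono[OF assms(1), of 0 i] Suc.prems by simp
qed simp

text \<open>Each coefficient is \<open>fact (L (i - 1) - 1)\<close> over
  \<open>fact (L i - 1) * fact (L (i - 1) - L i)\<close>, so the product telescopes. Partial
  products up to \<open>j\<close> allow induction, and \<open>1 \<le> L m\<close> keeps all entries
  of the chain positive, so predecessors in \<open>int\<close> and \<open>nat\<close> agree.\<close>

lemma prod_binomial_chain:
  assumes "decreasing_chain m L" "1 \<le> L m" "j \<le> m"
  shows "(\<Prod>i=1..j. of_nat (int_binom (int (L (i - 1)) - 1) (int (L i) - 1)))
       = (fact (L 0 - 1) / ((\<Prod>i=1..j. fact (L (i - 1) - L i)) * fact (L j - 1)) :: complex)"
  using assms(3)
proof (induction j)
  case (Suc j)
  have le: "L (Suc j) \<le> L j" and pos: "1 \<le> L (Suc j)"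
    using decreasing_chain_antimono[OF assms(1)] Suc.prems assms(2) le_trans by fastforce+
  have "int_binom (int (L j) - 1) (int (L (Suc j)) - 1) = (L j - 1) choose (L (Suc j) - 1)"
    using le pos by (simp add: int_binom_def nat_diff_distrib)
  also have "of_nat \<dots>
      = (fact (L j - 1) / (fact (L (Suc j) - 1) * fact (L j - L (Suc j))) :: complex)"
    using le pos by (subst binomial_fact) auto
  finally show ?case using Suc by simp
qed simp

lemma chain_term_eq_multinom:
  assumes "decreasing_chain m L" "1 \<le> L m"
  defines "ks \<equiv> chain_steps m L"
  shows "chain_term a m L = multinom (L 0 - 1) m ks (L m - 1) *
           (\<Prod>i=1..m. (- a * (of_nat (L 0) - (\<Sum>j=i+1..m. of_nat (ks j)))) ^ ks i)"
proof -
  have "(\<Prod>i=1..m. fact (L (i - 1) - L i)) = (\<Prod>i=1..m. fact (ks i) :: complex)"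
    \<comment> \<open>Substituting \<open>m + 1 - i\<close> for \<open>i\<close> accounts for the
      opposite numbering of chain and steps.\<close>
    by (subst prod.atLeastAtMost_rev) (auto intro!: prod.cong simp: ks_def chain_steps_def)
  then have coeff: "(\<Prod>i=1..m. of_nat (int_binom (int (L (i - 1)) - 1) (int (L i) - 1)))
      = multinom (L 0 - 1) m ks (L m - 1)"
    using prod_binomial_chain[OF assms(1,2) order_refl] by (simp add: multinom_def)
  have base: "(of_nat (L 0) - (\<Sum>j=i+1..m. of_nat (ks j)) :: complex) = of_nat (L (m - i))"
    if "i \<le> m" for i
  proof -
    have "(\<Sum>j=i+1..m. ks j) = L 0 - L (m - i)"
      using sum_chain_steps[OF assms(1), of "m - i"] that by (simp add: ks_def Suc_diff_le)
    moreover have "L (m - i) \<le> L 0"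
      using decreasing_chain_antimono[OF assms(1)] by simp
    ultimately show ?thesis
      by (simp flip: of_nat_sum add: of_nat_diff)
  qed
  have "(\<Prod>i=1..m. (- a * of_nat (L (i - 1))) powi (int (L (i - 1)) - int (L i)))
      = (\<Prod>i=1..m. (- a * of_nat (L (i - 1))) ^ (L (i - 1) - L i))"
    using assms(1)
    \<comment> \<open>All exponents are nonnegative along a decreasing chain, so \<open>powi\<close>
      becomes an ordinary power.\<close>
    by (intro prod.cong refl) (simp add: decreasing_chain_def flip: of_nat_diff)
  also have "\<dots> = (\<Prod>i=1..m. (- a * of_nat (L (m - i))) ^ ks i)"
    by (subst prod.atLeastAtMost_rev) (auto intro!: prod.cong simp: ks_def chain_steps_def)
  also have "\<dots> = (\<Prod>i=1..m. (- a * (of_nat (L 0) - (\<Sum>j=i+1..m. of_nat (ks j)))) ^ ks i)"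
    by (intro prod.cong refl) (simp only: base atLeastAtMost_iff)
  finally show ?thesis using coeff by (simp add: chain_term_def)
qed

text \<open>The prescribed endpoints are the values of \<open>chain_of_steps\<close> itself: at
  \<open>m\<close> all steps are subtracted, leaving \<open>n - (n - k) = k\<close>.\<close>

lemma with_ends_chain_of_steps:
  assumes "ks \<in> compositions m (n - k)" "k \<le> n" "1 \<le> m" "i \<le> m"
  shows "with_ends m n k (restrict (chain_of_steps m n ks) {1..m - 1}) i = chain_of_steps m n ks i"
  using assms by (auto simp: with_ends_def chain_of_steps_def compositions_def)

lemma chain_of_steps_Suc:
  assumes "i < m"
  shows "chain_of_steps m n ks (Suc i) = chain_of_steps m n ks i - ks (m - i)"
proof -
  have "(\<Sum>j=m - i..m. ks j) = ks (m - i) + (\<Sum>j=Suc (m - i)..m. ks j)"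
    using assms by (intro sum.atLeast_Suc_atMost) simp
  then show ?thesis using assms by (simp add: chain_of_steps_def Suc_diff_le)
qed

lemma chain_steps_chain_of_steps:
  assumes "ks \<in> compositions m s" "s \<le> n"
  shows "chain_steps m (chain_of_steps m n ks) = ks"
proof
  fix j
  show "chain_steps m (chain_of_steps m n ks) j = ks j"
  proof (cases "j \<in> {1..m}")
    case True
    \<comment> \<open>Bounding this tail sum by \<open>n\<close> ensures that no subtraction in
      \<open>chain_of_steps\<close> truncates, so \<open>ks j\<close> is recovered exactly.\<close>
    have "ks j + (\<Sum>j=Suc j..m. ks j) = (\<Sum>j=j..m. ks j)"
      using True by (subst sum.atLeast_Suc_atMost[of j m]) auto
    also have "\<dots> \<le> (\<Sum>j=1..m. ks j)"
      using True by (intro sum_mono2) auto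
    also have "\<dots> \<le> n" using assms by (simp add: compositions_def)
    finally show ?thesis
      using True chain_of_steps_Suc[of "m - j" m n ks]
      by (simp add: chain_steps_def chain_of_steps_def Suc_diff_le)
  next
    case False
    have "ks \<in> {1..m} \<rightarrow>\<^sub>E UNIV"
      using assms(1) by (simp add: compositions_def)
    then have "ks j = undefined"
      using False by (rule PiE_arb)
    then show ?thesis
      using False by (simp only: chain_steps_def restrict_apply if_False)
  qed
qed

theorem theorem3:
  fixes a :: complex and n m k :: nat
  assumes "a \<noteq> 0" and "n \<ge> 1" and "m \<ge> 1" and "1 \<le> k" and "k \<le> n"
  shows "(\<Sum>l \<in> {1..m - 1} \<rightarrow>\<^sub>E {0..n}. chain_term a m (with_ends m n k l))
       = (\<Sum>ks \<in> compositions m (n - k).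
            multinom (n - 1) m ks (k - 1) *
            (\<Prod>i=1..m. (- a * (of_nat n - (\<Sum>j=i+1..m. of_nat (ks j)))) ^ ks i))"
proof -
  define P where "P = {1..m - 1} \<rightarrow>\<^sub>E {0..n}"
  define E where "E = with_ends m n k"
  define S where "S = {l \<in> P. decreasing_chain m (E l)}"
  have ends: "E l 0 = n" "E l m = k" for l
    using assms by (auto simp: E_def with_ends_def)
  have "(\<Sum>l\<in>P. chain_term a m (E l)) = (\<Sum>l\<in>S. chain_term a m (E l))"
    by (rule sum.mono_neutral_right)
      (auto simp: P_def S_def chain_term_eq_0 intro!: finite_PiE)
  also have "\<dots> = (\<Sum>ks \<in> compositions m (n - k).
            multinom (n - 1) m ks (k - 1) *
            (\<Prod>i=1..m. (- a * (of_nat n - (\<Sum>j=i+1..m. of_nat (ks j)))) ^ ks i))"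
  proof (rule sum.reindex_bij_witness[where
        i = "\<lambda>ks. restrict (chain_of_steps m n ks) {1..m - 1}" and
        j = "\<lambda>l. chain_steps m (E l)"])
    fix l assume "l \<in> S"
    then have dec: "decreasing_chain m (E l)" and P: "l \<in> {1..m - 1} \<rightarrow>\<^sub>E {0..n}"
      by (auto simp: S_def P_def)
    show "restrict (chain_of_steps m n (chain_steps m (E l))) {1..m - 1} = l"
    proof
      fix i
      show "restrict (chain_of_steps m n (chain_steps m (E l))) {1..m - 1} i = l i"
      proof (cases "i \<in> {1..m - 1}")
        case True
        then have "i \<le> m" and "E l i = l i" by (auto simp: E_def with_ends_def)
        moreover have "l i \<le> n" using P True by (auto dest: PiE_mem)
        ultimately show ?thesis
          using True sum_chain_steps[OF dec, of i]
          by (simp add: chain_of_steps_def ends)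
      next
        case False
        then show ?thesis using PiE_arb[OF P False] by (simp only: restrict_apply if_False)
      qed
    qed
    show "chain_steps m (E l) \<in> compositions m (n - k)"
      using sum_chain_steps[OF dec order_refl]
      by (simp add: compositions_def ends) (simp add: chain_steps_def)
    show "multinom (n - 1) m (chain_steps m (E l)) (k - 1) *
        (\<Prod>i=1..m. (- a * (of_nat n - (\<Sum>j=i+1..m. of_nat (chain_steps m (E l) j))))
          ^ chain_steps m (E l) i) = chain_term a m (E l)"
      using chain_term_eq_multinom[OF dec] assms by (simp add: ends)
  next
    fix ks assume ks: "ks \<in> compositions m (n - k)"
    define l where "l = restrict (chain_of_steps m n ks) {1..m - 1}"
    have E_l: "E l i = chain_of_steps m n ks i" if "i \<le> m" for i
      unfolding E_def l_def using with_ends_chain_of_steps ks that assms by blast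
    \<comment> \<open>Only positions \<open>0\<close> to \<open>m\<close> enter
      \<open>chain_steps\<close>, and there \<open>E l\<close> agrees with
      \<open>chain_of_steps\<close>.\<close>
    have "chain_steps m (E l) = chain_steps m (chain_of_steps m n ks)"
      unfolding chain_steps_def by (intro restrict_ext) (auto simp: E_l)
    also have "\<dots> = ks"
      by (rule chain_steps_chain_of_steps[OF ks]) simp
    finally show "chain_steps m (E (restrict (chain_of_steps m n ks) {1..m - 1})) = ks"
      unfolding l_def .
    \<comment> \<open>Each entry arises from its predecessor by subtraction in \<open>nat\<close>,
      which never increases it.\<close>
    have "E l i \<le> E l (i - 1)" if "i \<in> {1..m}" for i
      using that chain_of_steps_Suc[of "i - 1" m n ks] E_l[of "i - 1"] E_l[of i] by auto
    moreover have "l \<in> P"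
      by (auto simp: l_def P_def chain_of_steps_def)
    ultimately have "l \<in> S"
      by (simp add: S_def decreasing_chain_def)
    then show "restrict (chain_of_steps m n ks) {1..m - 1} \<in> S"
      unfolding l_def .
  qed
  finally show ?thesis by (simp only: P_def E_def)
qed

end
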